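(* Let $f:[0,1]^2\to[0,1]$, $\mathcal{C}:[0,1)^2\to[0,1)$ and the sequence $(A_n)_{n\in\mathbb{N}}$ of subsets of $[0,1]^2$ be as defined in the context, and let $f^*:[0,1]^2\to[0,1]$ be defined by $f^*(x,y)=f(x,y)$ if $(x,y)\in\bigcup_{n\in\mathbb{N}}A_n$ and $f^*(x,y)=x$ otherwise. Then $f^*=f$ almost everywhere on $[0,1]^2$ with respect to the Lebesgue measure on $\mathbb{R}^2$, and $\mathcal{C}=f^*$ almost everywhere (that is, the set of points of $[0,1)^2$ at which $\mathcal{C}$ and $f^*$ differ has Lebesgue measure zero).
   Context: Here $\mathbb{N}=\{0,1,2,\dots\}$. For a real number $x\in[0,1)$, its proper decimal expansion is the unique sequence $(x_k)_{k\ge 1}$ of digits in $\{0,1,\dots,9\}$ such that $x=\sum_{k=1}^{+\infty}x_k/10^k$ and there is no $k_0$ such that $x_k=9$ for all $k>k_0$. The function $\mathcal{C}:[0,1)^2\to[0,1)$ is defined by $\mathcal{C}(x,y)=\sum_{k=1}^{+\infty}\frac{x_k}{10^{2k-1}}+\sum_{k=1}^{+\infty}\frac{y_k}{10^{2k}}$, where $(x_k)_{k\ge1}$ and $(y_k)_{k\ge1}$ are the proper decimal expansions of $x$ and $y$. The function $f:[0,1]^2\to[0,1]$ is defined as follows, where $(x_k)_{k\ge1}$ and $(y_k)_{k\ge1}$ denote the proper decimal expansions of $x$ and $y$ whenever these numbers lie in $[0,1)$: \[ f(x,y)=\begin{cases} \mathcal{C}(x,y) & \text{if }(x,y)\in[0,1)^2,\\[2pt]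 \sum_{k=1}^{+\infty}\frac{9}{10^{2k-1}}+\sum_{k=1}^{+\infty}\frac{y_k}{10^{2k}} & \text{if }(x,y)\in\{1\}\times[0,1),\\[2pt] \sum_{k=1}^{+\infty}\frac{x_k}{10^{2k-1}}+\sum_{k=1}^{+\infty}\frac{9}{10^{2k}} & \text{if }(x,y)\in[0,1)\times\{1\},\\[2pt] 1 & \text{if }(x,y)=(1,1). \end{cases} \] The function $g:[0,1]\to[0,1]^2$ is defined by $g(t)=(t,0)$. The sets $A_n\subseteq[0,1]^2$ and $B_n\subseteq[0,1]$ are defined recursively by \[ A_0=[0,1]^2\setminus g([0,1])=[0,1]\times(0,1],\qquad B_n=f(A_n)\ \ (n\in\mathbb{N}),\qquad A_n=g(B_{n-1})=B_{n-1}\times\{0\}\ \ (n\ge1). \] *)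

theory Defs
  imports "HOL-Analysis.Analysis"
begin

(* Digit sequences are indexed from 0: the value d k is the (k+1)-st decimal digit,
   the one with weight 1 / 10^(k+1). *)
definition proper_decimal_expansion :: "real \<Rightarrow> (nat \<Rightarrow> nat) \<Rightarrow> bool" where
  "proper_decimal_expansion x d \<longleftrightarrow>
     (\<forall>k. d k \<in> {0..9}) \<and>
     (\<lambda>k. real (d k) / 10 ^ (k + 1)) sums x \<and>
     \<not> (\<exists>k0. \<forall>k\<ge>k0. d k = 9)"

definition proper_digits :: "real \<Rightarrow> nat \<Rightarrow> nat" where
  "proper_digits x = (THE d. proper_decimal_expansion x d)"

definition interleave_digits :: "(nat \<Rightarrow> nat) \<Rightarrow> (nat \<Rightarrow> nat) \<Rightarrow> real" where
  "interleave_digits d e =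
     (\<Sum>k. real (d k) / 10 ^ (2 * k + 1)) + (\<Sum>k. real (e k) / 10 ^ (2 * k + 2))"

(* The paper's functions have domain [0,1)^2, [0,1]^2 or [0,1]; the total functions below
   are meaningful only there, and take irrelevant values elsewhere. *)
definition calC :: "real \<times> real \<Rightarrow> real" where
  "calC = (\<lambda>(x, y). interleave_digits (proper_digits x) (proper_digits y))"

definition mapf :: "real \<times> real \<Rightarrow> real" where
  "mapf = (\<lambda>(x, y).
     if (x, y) \<in> {0..<1} \<times> {0..<1} then calC (x, y)
     else if (x, y) \<in> {1} \<times> {0..<1} then interleave_digits (\<lambda>_. 9) (proper_digits y)
     else if (x, y) \<in> {0..<1} \<times> {1} then interleave_digits (proper_digits x) (\<lambda>_. 9)
     else 1)"

definition mapg :: "real \<Rightarrow> real \<times> real" where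
  "mapg t = (t, 0)"

fun setA :: "nat \<Rightarrow> (real \<times> real) set" and setB :: "nat \<Rightarrow> real set" where
  "setA 0 = {0..1} \<times> {0..1} - mapg ` {0..1}"
| "setA (Suc n) = mapg ` setB n"
| "setB n = mapf ` setA n"

definition fstar :: "real \<times> real \<Rightarrow> real" where
  "fstar p = (if p \<in> (\<Union>n. setA n) then mapf p else fst p)"

lemma decimal_tail_bounds:
  fixes d :: "nat \<Rightarrow> nat"
  assumes "\<And>k. d k \<le> 9" "\<exists>k. d k \<noteq> 9"
  shows "summable (\<lambda>k. real (d k) / 10 ^ (k + 1))"
    and "0 \<le> (\<Sum>k. real (d k) / 10 ^ (k + 1))"
    and "(\<Sum>k. real (d k) / 10 ^ (k + 1)) < 1"
proof -
  have nine: "(\<lambda>k. 9 / 10 ^ (k + 1) :: real) sums 1"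
    using sums_mult[OF geometric_sums[of "1/10::real"], of "9/10"] by (simp add: field_simps)
  have le: "real (d k) / 10 ^ (k + 1) \<le> 9 / 10 ^ (k + 1)" for k
    using assms(1)[of k] by (intro divide_right_mono) auto
  show s: "summable (\<lambda>k. real (d k) / 10 ^ (k + 1))"
    by (rule summable_comparison_test'[OF sums_summable[OF nine], of 0]) (use le in auto)
  show "0 \<le> (\<Sum>k. real (d k) / 10 ^ (k + 1))"
    by (intro suminf_nonneg s) auto
  obtain k where k: "d k \<noteq> 9" using assms(2) by blast
  then have "d k < 9" using assms(1)[of k] by linarith
  then have lt: "0 < 9 / 10 ^ (k + 1) - real (d k) / 10 ^ (k + 1)"
    by (simp add: divide_strict_right_mono)
  have "0 < (\<Sum>k. 9 / 10 ^ (k + 1) - real (d k) / 10 ^ (k + 1))"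
    by (rule suminf_pos2[OF summable_diff[OF sums_summable[OF nine] s] _ lt]) (use le in auto)
  then show "(\<Sum>k. real (d k) / 10 ^ (k + 1)) < 1"
    using suminf_diff[OF sums_summable[OF nine] s] sums_unique[OF nine] by simp
qed

lemma proper_decimal_expansion_digit:
  assumes "proper_decimal_expansion x d"
  shows "int (d k) = \<lfloor>x * 10 ^ (k + 1)\<rfloor> - 10 * \<lfloor>x * 10 ^ k\<rfloor>"
proof -
  have d9: "\<And>k. d k \<le> 9" and x: "(\<lambda>k. real (d k) / 10 ^ (k + 1)) sums x"
    and nt: "\<And>k0. \<exists>k\<ge>k0. d k \<noteq> 9"
    using assms unfolding proper_decimal_expansion_def by auto
  define M where "M n = (\<Sum>i<n. int (d i) * 10 ^ (n - 1 - i))" for n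
  have fl: "\<lfloor>x * 10 ^ n\<rfloor> = M n" for n
  proof -
    let ?t = "\<Sum>k. real (d (k + n)) / 10 ^ (k + 1)"
    have nx: "\<exists>k. d (k + n) \<noteq> 9" using nt[of n] by (metis le_add_diff_inverse2)
    note tb = decimal_tail_bounds[of "\<lambda>k. d (k + n)", OF d9 nx]
    have "x = (\<Sum>k. real (d (k + n)) / 10 ^ (k + n + 1)) + (\<Sum>i<n. real (d i) / 10 ^ (i + 1))"
      using suminf_split_initial_segment[OF sums_summable[OF x], of n] sums_unique[OF x] by simp
    moreover have "(\<Sum>k. real (d (k + n)) / 10 ^ (k + n + 1)) = ?t / 10 ^ n"
      using suminf_divide[OF tb(1), of "10 ^ n"] by (simp add: power_add field_simps)
    moreover have "(\<Sum>i<n. real (d i) / 10 ^ (i + 1)) * 10 ^ n = real_of_int (M n)"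
      unfolding M_def sum_distrib_right of_int_sum
    proof (rule sum.cong)
      fix i assume "i \<in> {..<n}"
      then have "(10::real) ^ n = 10 ^ (i + 1) * 10 ^ (n - 1 - i)"
        by (simp flip: power_add power_Suc)
      then show "real (d i) / 10 ^ (i + 1) * 10 ^ n = real_of_int (int (d i) * 10 ^ (n - 1 - i))"
        by simp
    qed simp
    ultimately have "x * 10 ^ n = ?t + real_of_int (M n)" by (simp add: distrib_right)
    then show ?thesis using tb(2,3) by linarith
  qed
  have "M (Suc k) = 10 * M k + int (d k)"
  proof -
    have "(\<Sum>i<k. int (d i) * 10 ^ (k - i)) = 10 * M k"
      unfolding M_def sum_distrib_left
    proof (rule sum.cong)
      fix i assume "i \<in> {..<k}"
      then have "k - i = Suc (k - 1 - i)" by auto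
      then show "int (d i) * 10 ^ (k - i) = 10 * (int (d i) * 10 ^ (k - 1 - i))" by simp
    qed simp
    then show ?thesis unfolding M_def by simp
  qed
  then show ?thesis using fl[of k] fl[of "k + 1"] by simp
qed

lemma proper_decimal_expansion_ex:
  assumes "x \<in> {0..<1}"
  shows "\<exists>d. proper_decimal_expansion x d"
proof -
  define F where "F n = \<lfloor>x * 10 ^ n\<rfloor>" for n
  define d where "d n = nat (F (Suc n) - 10 * F n)" for n
  have b: "real_of_int (F n) \<le> x * 10 ^ n" "x * 10 ^ n < real_of_int (F n) + 1" for n
    unfolding F_def by linarith+
  have ge: "0 \<le> F (Suc n) - 10 * F n" and le: "F (Suc n) - 10 * F n \<le> 9" for n
  proof -
    have "x * 10 ^ Suc n = 10 * (x * 10 ^ n)" by simp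
    then have "real_of_int (10 * F n) < real_of_int (F (Suc n) + 1)"
      "real_of_int (F (Suc n)) < real_of_int (10 * F n + 10)"
      using b[of n] b[of "Suc n"] by simp_all
    then show "0 \<le> F (Suc n) - 10 * F n" "F (Suc n) - 10 * F n \<le> 9"
      unfolding of_int_less_iff by linarith+
  qed
  have rd: "real (d n) = real_of_int (F (Suc n)) - 10 * real_of_int (F n)" for n
    unfolding d_def using ge[of n] by simp
  have F0: "F 0 = 0" unfolding F_def using assms by (simp add: floor_eq_iff)
  have part: "(\<Sum>k<n. real (d k) / 10 ^ (k + 1)) = real_of_int (F n) / 10 ^ n" for n
    by (induction n) (auto simp: F0 rd field_simps)
  have lim: "(\<lambda>n. real_of_int (F n) / 10 ^ n) \<longlonglongrightarrow> x"
  proof (rule tendsto_sandwich)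
    show "\<forall>\<^sub>F n in sequentially. x - (1/10) ^ n \<le> real_of_int (F n) / 10 ^ n"
    proof (rule always_eventually, rule allI)
      fix n
      have "(x * 10 ^ n - 1) / 10 ^ n \<le> real_of_int (F n) / 10 ^ n"
        using b(2)[of n] by (intro divide_right_mono) auto
      then show "x - (1/10) ^ n \<le> real_of_int (F n) / 10 ^ n"
        by (simp add: power_one_over diff_divide_distrib)
    qed
    show "\<forall>\<^sub>F n in sequentially. real_of_int (F n) / 10 ^ n \<le> x"
      using b by (simp add: field_simps)
    have "(\<lambda>n. (1/10 :: real) ^ n) \<longlonglongrightarrow> 0" by (rule LIMSEQ_realpow_zero) auto
    from tendsto_diff[OF tendsto_const this] show "(\<lambda>n. x - (1/10) ^ n) \<longlonglongrightarrow> x" by simp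
  qed simp
  have s: "(\<lambda>k. real (d k) / 10 ^ (k + 1)) sums x"
    unfolding sums_def part by (rule lim)
  have "\<not> (\<forall>k\<ge>k0. d k = 9)" for k0
  proof
    assume nine: "\<forall>k\<ge>k0. d k = 9"
    have step: "real_of_int (F (k0 + n)) + 1 = 10 ^ n * (real_of_int (F k0) + 1)" for n
    proof (induction n)
      case (Suc n)
      have "real (d (k0 + n)) = 9" using nine by simp
      then show ?case using rd[of "k0 + n"] Suc by simp
    qed simp
    define e where "e = real_of_int (F k0) + 1 - x * 10 ^ k0"
    have epos: "0 < e" unfolding e_def using b(2)[of k0] by simp
    obtain n where n: "(1/10 :: real) ^ n < e"
      using real_arch_pow_inv[OF epos, of "1/10"] by auto
    have "10 ^ n * e = real_of_int (F (k0 + n)) + 1 - x * 10 ^ (k0 + n)"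
      unfolding step e_def by (simp add: power_add algebra_simps)
    then have "10 ^ n * e \<le> 1" using b(1)[of "k0 + n"] by linarith
    then show False using n by (simp add: power_one_over field_simps)
  qed
  moreover have "d k \<in> {0..9}" for k unfolding d_def using le[of k] by auto
  ultimately show ?thesis using s unfolding proper_decimal_expansion_def by blast
qed

lemma proper_decimal_expansion_ex1:
  assumes "x \<in> {0..<1}"
  shows "\<exists>!d. proper_decimal_expansion x d"
proof (rule ex_ex1I[OF proper_decimal_expansion_ex[OF assms]])
  fix d e assume "proper_decimal_expansion x d" "proper_decimal_expansion x e"
  then have "int (d k) = int (e k)" for k by (simp add: proper_decimal_expansion_digit)
  then show "d = e" by auto
qed

lemma interleave_digits_bounds:
  assumes d: "\<And>k. d k \<le> 9" and e: "\<And>k. e k \<le> 9"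
  shows "interleave_digits d e \<in> {0..1}"
    and "\<exists>k. d k \<noteq> 9 \<Longrightarrow> interleave_digits d e < 1"
proof -
  have pw: "(10::real) ^ (2 * k) = 100 ^ k" for k by (simp add: power_mult)
  have q: "(\<lambda>k. (1/100::real) ^ k) sums (100/99)"
    using geometric_sums[of "1/100::real"] by simp
  have n1: "(\<lambda>k. 9 / 10 ^ (2 * k + 1) :: real) sums (10/11)"
    using sums_mult[OF q, of "9/10"] by (simp add: pw power_one_over)
  have n2: "(\<lambda>k. 9 / 10 ^ (2 * k + 2) :: real) sums (1/11)"
    using sums_mult[OF q, of "9/100"] by (simp add: pw power_one_over)
  have le1: "real (d k) / 10 ^ (2 * k + 1) \<le> 9 / 10 ^ (2 * k + 1)" for k
    using d[of k] by (intro divide_right_mono) auto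
  have le2: "real (e k) / 10 ^ (2 * k + 2) \<le> 9 / 10 ^ (2 * k + 2)" for k
    using e[of k] by (intro divide_right_mono) auto
  have s1: "summable (\<lambda>k. real (d k) / 10 ^ (2 * k + 1))"
    by (rule summable_comparison_test'[OF sums_summable[OF n1], of 0]) (use le1 in auto)
  have s2: "summable (\<lambda>k. real (e k) / 10 ^ (2 * k + 2))"
    by (rule summable_comparison_test'[OF sums_summable[OF n2], of 0]) (use le2 in auto)
  have u1: "(\<Sum>k. real (d k) / 10 ^ (2 * k + 1)) \<le> 10/11"
    unfolding sums_unique[OF n1] by (intro suminf_le s1 sums_summable[OF n1] le1)
  have u2: "(\<Sum>k. real (e k) / 10 ^ (2 * k + 2)) \<le> 1/11"
    unfolding sums_unique[OF n2] by (intro suminf_le s2 sums_summable[OF n2] le2)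
  have p1: "0 \<le> (\<Sum>k. real (d k) / 10 ^ (2 * k + 1))" by (intro suminf_nonneg s1) auto
  have p2: "0 \<le> (\<Sum>k. real (e k) / 10 ^ (2 * k + 2))" by (intro suminf_nonneg s2) auto
  show "interleave_digits d e \<in> {0..1}"
    unfolding interleave_digits_def using u1 u2 p1 p2 by simp
  assume "\<exists>k. d k \<noteq> 9"
  then obtain k where k: "d k \<noteq> 9" by blast
  then have "d k < 9" using d[of k] by linarith
  then have lt: "0 < 9 / 10 ^ (2 * k + 1) - real (d k) / 10 ^ (2 * k + 1)"
    by (simp add: divide_strict_right_mono)
  have "0 < (\<Sum>k. 9 / 10 ^ (2 * k + 1) - real (d k) / 10 ^ (2 * k + 1))"
    by (rule suminf_pos2[OF summable_diff[OF sums_summable[OF n1] s1] _ lt]) (use le1 in auto)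
  then have "(\<Sum>k. real (d k) / 10 ^ (2 * k + 1)) < 10/11"
    using suminf_diff[OF sums_summable[OF n1] s1] sums_unique[OF n1] by simp
  then show "interleave_digits d e < 1"
    unfolding interleave_digits_def using u2 by simp
qed

lemma proper_digits_props:
  assumes "x \<in> {0..<1}"
  shows "proper_digits x k \<le> 9" and "\<exists>k. proper_digits x k \<noteq> 9"
proof -
  have "proper_decimal_expansion x (proper_digits x)"
    unfolding proper_digits_def by (rule theI'[OF proper_decimal_expansion_ex1[OF assms]])
  then show "proper_digits x k \<le> 9" "\<exists>k. proper_digits x k \<noteq> 9"
    unfolding proper_decimal_expansion_def by auto
qed

lemma calC_in: "p \<in> {0..<1} \<times> {0..<1} \<Longrightarrow> calC p \<in> {0..<1}"
  using interleave_digits_bounds[of "proper_digits (fst p)" "proper_digits (snd p)"]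
  by (auto simp: calC_def proper_digits_props)

lemma mapf_in:
  assumes "p \<in> {0..1} \<times> {0..1}"
  shows "mapf p \<in> {0..1}"
proof -
  obtain x y where p: "p = (x, y)" by fastforce
  have "x \<in> {0..<1} \<or> x = 1" "y \<in> {0..<1} \<or> y = 1" using assms p by auto
  then show ?thesis
    using calC_in[of p]
      interleave_digits_bounds(1)[of "\<lambda>_. 9" "proper_digits y"]
      interleave_digits_bounds(1)[of "proper_digits x" "\<lambda>_. 9"]
      proper_digits_props(1)[of x] proper_digits_props(1)[of y]
    unfolding mapf_def p by (elim disjE) auto
qed

lemma fstar_in: "p \<in> {0..1} \<times> {0..1} \<Longrightarrow> fstar p \<in> {0..1}"
  using mapf_in[of p] by (auto simp: fstar_def)

lemma setA_0: "setA 0 = {0..1} \<times> {0<..1}"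
  by (auto simp: mapg_def image_iff)

end

theory Submission
  imports Defs
begin

text \<open>The set \<open>setA 0\<close> is already the whole square minus its bottom edge, so
  \<open>fstar\<close> can differ from \<open>mapf\<close> only where y = 0
  (\<open>fstar_eq_mapf\<close>). That line is Lebesgue null
  (\<open>null_sets_horizontal_axis\<close>). On the half-open square \<open>mapf\<close> is
  \<open>calC\<close> by definition, so the second disagreement set lies on the same line.\<close>

lemma null_sets_horizontal_axis: "{p :: real \<times> real. snd p = 0} \<in> null_sets lebesgue"
proof -
  \<comment> \<open>The axis is the hyperplane orthogonal to a basis vector.\<close>
  have "(0, 1) \<in> (Basis :: (real \<times> real) set)"
    by (simp add: Basis_prod_def)
  then have "negligible {p :: real \<times> real. p \<bullet> (0, 1) = 0}"
    by (rule negligible_standard_hyperplane)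
  moreover have "{p :: real \<times> real. p \<bullet> (0, 1) = 0} = {p. snd p = 0}"
    by (auto simp: inner_prod_def)
  ultimately show ?thesis
    by (simp add: negligible_iff_null_sets)
qed

text \<open>The strip is \<open>setA 0\<close>, one of the sets in the union that selects the
  \<open>mapf\<close> branch of \<open>fstar\<close>.\<close>

lemma fstar_eq_mapf:
  assumes "p \<in> {0..1} \<times> {0<..1}"
  shows "fstar p = mapf p"
proof -
  have "p \<in> (\<Union>n. setA n)"
    using assms setA_0 by blast
  then show ?thesis
    by (simp add: fstar_def)
qed

theorem mainTheorem2:
  shows "(AE p in lebesgue_on ({0..1} \<times> {0..1}). fstar p = mapf p) \<and>
         {p \<in> {0..<1} \<times> {0..<1}. calC p \<noteq> fstar p} \<in> null_sets lebesgue"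
proof
  \<comment> \<open>As a closed box the square is measurable, which allows the restricted AE
    statement to become an implication under \<open>lebesgue\<close>.\<close>
  have "({0..1} \<times> {0..1} :: (real \<times> real) set) = cbox (0, 0) (1, 1)"
    by (simp add: cbox_Pair_eq)
  then have square: "({0..1} \<times> {0..1} :: (real \<times> real) set) \<in> sets lebesgue"
    by simp
  have "AE p :: real \<times> real in lebesgue. p \<in> {0..1} \<times> {0..1} \<longrightarrow> fstar p = mapf p"
    by (rule AE_I'[OF null_sets_horizontal_axis]) (force intro: fstar_eq_mapf)
  with square show "AE p in lebesgue_on ({0..1} \<times> {0..1}). fstar p = mapf p"
    by (simp add: AE_restrict_space_iff)
next
  have "{p \<in> {0..<1} \<times> {0..<1}. calC p \<noteq> fstar p} \<subseteq> {p. snd p = 0}"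
  proof clarsimp
    fix x y :: real
    assume xy: "0 \<le> x" "x < 1" "0 \<le> y" "y < 1" "calC (x, y) \<noteq> fstar (x, y)"
    then have "mapf (x, y) = calC (x, y)"
      by (simp add: mapf_def)
    with xy fstar_eq_mapf[of "(x, y)"] show "y = 0"
      by force
  qed
  \<comment> \<open>Lebesgue measure is complete, so any subset of the null axis is measurable and
    null; no measurability of \<open>calC\<close> or \<open>fstar\<close> has to be shown.\<close>
  then show "{p \<in> {0..<1} \<times> {0..<1}. calC p \<noteq> fstar p} \<in> null_sets lebesgue"
    using null_sets_horizontal_axis by (rule null_sets_completion_subset)
qed

end
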